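(* Write points of $\mathbb R^6$ as $(p,z)\in\mathbb R^2\times\mathbb R^4$ with $p=(p_1,p_2)$ and $z=(z_1,\dots,z_4)$. Define $q=(q_1,q_2)\colon\mathbb R^2\to\mathbb R^2$ by $q(p)=2p$ if $|p|\leq1/2$ and $q(p)=p/|p|$ if $|p|>1/2$. Set $a_1=2+q_1$, $a_2=2-q_1$, $a_3=2+q_2$, $a_4=2-q_2$, and define $f\colon\mathbb R^6\to\mathbb R$ by $$f(p,z):=\sum_{i=1}^4a_i(p)|z_i|.$$ The function $f$ is locally Lipschitz and semialgebraic. For every real $K\geq1$, there exist a bounded, nonconvergent sequence $(x_k)_{k\in\mathbb N}$ in $\mathbb R^6$ satisfying $x_{k+1}\in x_k-\alpha_k\,\partial f(x_k)$ for all $k\in\mathbb N$, with $\alpha_k=(k+K)^{-1/2}$, and a radius $r_\infty\geq1$ such that $f(x_k)\to0$ and the set of accumulation points of $(x_k)$ is $\{(p,0)\in\mathbb R^2\times\mathbb R^4:|p|=r_\infty\}$.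
   Context: $\partial f$ is the Clarke subdifferential and $|\cdot|$ is the Euclidean norm (absolute value on $\mathbb R$). *)

theory Defs
  imports "HOL-Analysis.Analysis"
begin

text \<open>
  The set-valued notions are defined over an arbitrary real inner product or normed space.
  Euclidean space \<open>R\<^sup>6\<close> is the product \<open>(real^2) \<times> (real^4)\<close>; the library's norm and inner product
  on this product type are the Euclidean ones.
\<close>

definition locally_lipschitz :: "('a::metric_space \<Rightarrow> 'b::metric_space) \<Rightarrow> bool" where
  "locally_lipschitz f \<longleftrightarrow> (\<forall>x. \<exists>u>0. \<exists>L. L-lipschitz_on (cball x u) f)"

text \<open>
  The smallest family of sets that contains all sets \<open>{x. P x > 0}\<close>, for \<open>P\<close> a polynomial, and is
  closed under complements and finite unions (hence also under finite intersections). On a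
  finite-dimensional space, \<^const>\<open>real_polynomial_function\<close> holds exactly of the polynomials in the
  coordinates.
\<close>

inductive semialgebraic_set :: "'a::euclidean_space set \<Rightarrow> bool" where
  pos: "real_polynomial_function P \<Longrightarrow> semialgebraic_set {x. P x > 0}"
| Compl: "semialgebraic_set A \<Longrightarrow> semialgebraic_set (- A)"
| Un: "semialgebraic_set A \<Longrightarrow> semialgebraic_set B \<Longrightarrow> semialgebraic_set (A \<union> B)"

definition semialgebraic_function :: "('a::euclidean_space \<Rightarrow> real) \<Rightarrow> bool" where
  "semialgebraic_function f \<longleftrightarrow> semialgebraic_set {(x, t). t = f x}"

text \<open>
  Clarke's generalized directional derivative, the upper limit of \<open>(f (y + t d) - f y) / t\<close> as
  \<open>y\<close> tends to \<open>x\<close> (the value \<open>y = x\<close> being allowed) and \<open>t\<close> decreases to \<open>0\<close>. It is finite when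
  \<open>f\<close> is Lipschitz near \<open>x\<close>; the extended reals make the upper limit meaningful in general.
\<close>

definition clarke_dderiv :: "('a::real_normed_vector \<Rightarrow> real) \<Rightarrow> 'a \<Rightarrow> 'a \<Rightarrow> ereal" where
  "clarke_dderiv f x d =
     Limsup (nhds x \<times>\<^sub>F at_right 0) (\<lambda>(y, t). ereal ((f (y + t *\<^sub>R d) - f y) / t))"

definition clarke_subdifferential :: "('a::real_inner \<Rightarrow> real) \<Rightarrow> 'a \<Rightarrow> 'a set" where
  "clarke_subdifferential f x = {v. \<forall>d. ereal (v \<bullet> d) \<le> clarke_dderiv f x d}"

definition accumulation_points :: "(nat \<Rightarrow> 'a::topological_space) \<Rightarrow> 'a set" where
  "accumulation_points x = {l. \<exists>r. strict_mono r \<and> (x \<circ> r) \<longlonglongrightarrow> l}"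

definition q_map :: "real^2 \<Rightarrow> real^2" where
  "q_map p = (if norm p \<le> 1 / 2 then 2 *\<^sub>R p else p /\<^sub>R norm p)"

text \<open>In the index type \<open>4\<close> the numeral \<open>4\<close> denotes the same element as \<open>0\<close>; it is the last case.\<close>

definition a_coef :: "4 \<Rightarrow> real^2 \<Rightarrow> real" where
  "a_coef i p =
     (if i = 1 then 2 + q_map p $ 1
      else if i = 2 then 2 - q_map p $ 1
      else if i = 3 then 2 + q_map p $ 2
      else 2 - q_map p $ 2)"

definition f_obj :: "(real^2) \<times> (real^4) \<Rightarrow> real" where
  "f_obj = (\<lambda>(p, z). \<Sum>i\<in>UNIV. a_coef i p * \<bar>z $ i\<bar>)"

end

theory Submission
  imports Defs
begin

text \<open>
  The sequence alternates between the critical set \<open>z = 0\<close> and points with a single nonzero \<open>z\<^sub>i\<close>. At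
  \<open>(p, 0)\<close> the subdifferential contains \<open>(0, s a\<^sub>i(p) e\<^sub>i)\<close> for all \<open>\<bar>s\<bar> \<le> 1\<close>, so one may step to
  \<open>z\<^sub>i = \<alpha> a\<^sub>i(p)\<close>, where \<open>\<alpha>\<close> is the next step size; the following subgradient step returns exactly to
  \<open>z = 0\<close> and moves \<open>p\<close> by \<open>- \<alpha>\<^sup>2 a\<^sub>i(p) \<nabla>a\<^sub>i(p)\<close>, which is orthogonal to \<open>p\<close> because \<open>q\<close> is
  homogeneous of degree 0 off the small disc. Choosing \<open>i\<close> suitably makes \<open>p\<close> always turn
  counterclockwise, by an angle comparable to \<open>1 / k\<close>: the total angle diverges while the increments
  tend to 0. By Pythagoras \<open>\<bar>p\<bar>\<^sup>2\<close> grows by \<open>O(1 / k\<^sup>2)\<close>, so \<open>\<bar>p\<bar>\<close> converges.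
\<close>

section \<open>Clarke subgradients from smooth minorants\<close>

text \<open>The upper limit in \<open>clarke_dderiv\<close> admits the constant base point
  \<open>y = x\<close>. There the quotients of \<open>f\<close> dominate those of \<open>g\<close>,
  which tend to \<open>v \<bullet> d\<close>.\<close>

lemma clarke_subdifferential_minorant:
  fixes f g :: "'a::real_inner \<Rightarrow> real"
  assumes le: "\<And>y. g y \<le> f y" and eq: "g x = f x"
    and der: "(g has_derivative (\<lambda>d. v \<bullet> d)) (at x)"
  shows "v \<in> clarke_subdifferential f x"
  unfolding clarke_subdifferential_def
proof (intro CollectI allI)
  fix d
  let ?Q = "\<lambda>(y, t). ereal ((f (y + t *\<^sub>R d) - f y) / t)"
  have lim: "((\<lambda>t. (g (x + t *\<^sub>R d) - g x) / t) \<longlongrightarrow> v \<bullet> d) (at_right 0)"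
  proof -
    have "((\<lambda>t. g (x + t *\<^sub>R d)) has_derivative (\<lambda>t. v \<bullet> (t *\<^sub>R d))) (at 0)"
    proof (rule has_derivative_compose[where g = g and f = "\<lambda>t. x + t *\<^sub>R d" and x = 0 and s = UNIV])
      show "((\<lambda>t::real. x + t *\<^sub>R d) has_derivative (\<lambda>t. t *\<^sub>R d)) (at 0)"
        by (auto intro!: derivative_eq_intros)
      show "(g has_derivative (\<lambda>d. v \<bullet> d)) (at (x + 0 *\<^sub>R d))"
        using der by simp
    qed
    then have "((\<lambda>t. g (x + t *\<^sub>R d)) has_real_derivative v \<bullet> d) (at 0)"
      by (simp add: has_field_derivative_def mult_commute_abs)
    then have "((\<lambda>t. (g (x + t *\<^sub>R d) - g x) / t) \<longlongrightarrow> v \<bullet> d) (at 0)"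
      by (simp add: has_field_derivative_iff)
    then show ?thesis
      by (rule filterlim_mono) (auto intro: at_le)
  qed
  show "ereal (v \<bullet> d) \<le> clarke_dderiv f x d"
  proof (rule ereal_le_real, rule ccontr)
    fix c
    assume c: "clarke_dderiv f x d \<le> ereal c" and n: "\<not> ereal (v \<bullet> d) \<le> ereal c"
    obtain b where b: "c < b" "b < v \<bullet> d"
      using n dense[of c "v \<bullet> d"] by auto
    have "Limsup (nhds x \<times>\<^sub>F at_right 0) ?Q < ereal b"
      using c b(1) unfolding clarke_dderiv_def by (meson ereal_less_eq(3) le_less_trans less_ereal.simps(1))
    then have "\<forall>\<^sub>F w in nhds x \<times>\<^sub>F at_right 0. ?Q w < ereal b"
      by (rule Limsup_lessD)
    \<comment> \<open>Restricts the product filter to the base point \<open>x\<close>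
      itself.\<close>
    moreover have "filterlim (\<lambda>t. (x, t)) (nhds x \<times>\<^sub>F at_right 0) (at_right (0::real))"
      by (intro filterlim_Pair filterlim_ident) (simp add: tendsto_const)
    ultimately have "\<forall>\<^sub>F t in at_right 0. ?Q (x, t) < ereal b"
      by (rule eventually_compose_filterlim)
    then have "\<forall>\<^sub>F t in at_right 0. (g (x + t *\<^sub>R d) - g x) / t \<le> b"
      using eventually_at_right_less[of 0]
    proof eventually_elim
      case (elim t)
      have "(g (x + t *\<^sub>R d) - g x) / t \<le> (f (x + t *\<^sub>R d) - f x) / t"
        using le eq elim by (intro divide_right_mono) auto
      then show ?case using elim by simp
    qed
    then have "v \<bullet> d \<le> b"
      using tendsto_upperbound[OF lim] by simp
    then show False using b by simp
  qed
qed

section \<open>Semialgebraic sets and piecewise polynomials\<close>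

text \<open>
  Sums of semialgebraic functions are semialgebraic only by quantifier elimination. Piecewise
  polynomials are visibly closed under the arithmetic operations and absolute values, and suffice here.
\<close>

inductive pwpoly :: "('a::euclidean_space \<Rightarrow> real) \<Rightarrow> bool" where
  poly: "real_polynomial_function P \<Longrightarrow> pwpoly P"
| If: "semialgebraic_set A \<Longrightarrow> pwpoly f \<Longrightarrow> pwpoly g \<Longrightarrow> pwpoly (\<lambda>x. if x \<in> A then f x else g x)"

lemma semialgebraic_set_Int:
  "semialgebraic_set A \<Longrightarrow> semialgebraic_set B \<Longrightarrow> semialgebraic_set (A \<inter> B)"
  using semialgebraic_set.Compl[OF semialgebraic_set.Un[OF semialgebraic_set.Compl semialgebraic_set.Compl], of A B]
  by simp

text \<open>Induction over the pieces: a case distinction passes through \<open>h\<close>. As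
  \<open>h\<close> may depend on \<open>x\<close>, a second function can be held fixed inside it, so
  two applications settle a binary operation.\<close>

lemma pwpoly_compose:
  assumes "pwpoly f" and "\<And>P. real_polynomial_function P \<Longrightarrow> pwpoly (\<lambda>x. h x (P x))"
  shows "pwpoly (\<lambda>x. h x (f x))"
  using assms
proof (induction rule: pwpoly.induct)
  case (If A f g)
  then have "pwpoly (\<lambda>x. if x \<in> A then h x (f x) else h x (g x))"
    by (intro pwpoly.If) auto
  then show ?case by (simp add: if_distrib)
next
  case (poly P)
  then show ?case by blast
qed

lemma semialgebraic_set_pwpoly_pos: "pwpoly f \<Longrightarrow> semialgebraic_set {x. f x > 0}"
proof (induction rule: pwpoly.induct)
  case (poly P)
  then show ?case by (rule semialgebraic_set.pos)
next
  case (If A f g)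
  have "{x. (if x \<in> A then f x else g x) > 0} = (A \<inter> {x. f x > 0}) \<union> (- A \<inter> {x. g x > 0})"
    by auto
  then show ?case
    using If by (auto intro!: semialgebraic_set.Un semialgebraic_set_Int semialgebraic_set.Compl)
qed

lemma pwpoly_const: "pwpoly (\<lambda>x. c)"
  by (intro pwpoly.poly real_polynomial_function.intros)

lemma pwpoly_add: "pwpoly f \<Longrightarrow> pwpoly g \<Longrightarrow> pwpoly (\<lambda>x. f x + g x)"
  by (erule pwpoly_compose[of f], erule pwpoly_compose[of g])
    (intro pwpoly.poly real_polynomial_function.intros(3))

lemma pwpoly_mult: "pwpoly f \<Longrightarrow> pwpoly g \<Longrightarrow> pwpoly (\<lambda>x. f x * g x)"
  by (erule pwpoly_compose[of f], erule pwpoly_compose[of g])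
    (intro pwpoly.poly real_polynomial_function.intros(4))

lemma pwpoly_diff: "pwpoly f \<Longrightarrow> pwpoly g \<Longrightarrow> pwpoly (\<lambda>x. f x - g x)"
  using pwpoly_add[OF _ pwpoly_mult[OF pwpoly_const[of "-1"]]] by fastforce

lemma pwpoly_abs: "pwpoly f \<Longrightarrow> pwpoly (\<lambda>x. \<bar>f x\<bar>)"
proof -
  assume f: "pwpoly f"
  have "pwpoly (\<lambda>x. if x \<in> {x. f x > 0} then f x else 0 - f x)"
    by (intro pwpoly.If semialgebraic_set_pwpoly_pos pwpoly_diff pwpoly_const f)
  moreover have "(\<lambda>x. if x \<in> {x. f x > 0} then f x else 0 - f x) = (\<lambda>x. \<bar>f x\<bar>)"
    by auto
  ultimately show ?thesis by simp
qed

lemma pwpoly_linear: "bounded_linear f \<Longrightarrow> pwpoly f"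
  by (intro pwpoly.poly real_polynomial_function.intros)

lemma semialgebraic_set_pwpoly_le:
  assumes "pwpoly f" "pwpoly g"
  shows "semialgebraic_set {x. f x \<le> g x}"
proof -
  have "{x. f x \<le> g x} = - {x. f x - g x > 0}" by auto
  then show ?thesis
    using assms by (simp only:) (intro semialgebraic_set.Compl semialgebraic_set_pwpoly_pos pwpoly_diff)
qed

lemma semialgebraic_set_pwpoly_eq:
  assumes "pwpoly f" "pwpoly g"
  shows "semialgebraic_set {x. f x = g x}"
proof -
  have "{x. f x = g x} = {x. f x \<le> g x} \<inter> {x. g x \<le> f x}" by auto
  then show ?thesis
    using assms by (auto intro!: semialgebraic_set_Int semialgebraic_set_pwpoly_le)
qed

section \<open>The coefficients\<close>

text \<open>Signed coordinate vectors, chosen so that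
  \<open>a_coef i p = 2 + adir i \<bullet> q_map p\<close> for all four indices.\<close>

definition adir :: "4 \<Rightarrow> real^2" where
  "adir i = (if i = 1 then axis 1 1 else if i = 2 then - axis 1 1
     else if i = 3 then axis 2 1 else - axis 2 1)"

lemma a_coef_adir: "a_coef i p = 2 + adir i \<bullet> q_map p"
  by (simp add: a_coef_def adir_def inner_axis')

lemma norm_adir: "norm (adir i) = 1"
  by (simp add: adir_def norm_axis_1)

lemma norm_q_map_le: "norm (q_map p) \<le> 1"
  by (simp add: q_map_def divide_simps)

lemma a_coef_bounds: "1 \<le> a_coef i p" "a_coef i p \<le> 3"
proof -
  have "\<bar>adir i \<bullet> q_map p\<bar> \<le> norm (adir i) * norm (q_map p)"
    by (rule Cauchy_Schwarz_ineq2)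
  also have "\<dots> \<le> 1" using norm_q_map_le by (simp add: norm_adir)
  finally show "1 \<le> a_coef i p" "a_coef i p \<le> 3" by (auto simp: a_coef_adir)
qed

text \<open>Projection onto a closed convex set is nonexpansive, so this form gives the Lipschitz
  constant 2 at once, on both sides of the circle \<open>norm p = 1 / 2\<close> and across
  it.\<close>

lemma q_map_closest_point: "q_map p = 2 *\<^sub>R closest_point (cball 0 (1 / 2)) p"
proof (cases "norm p \<le> 1 / 2")
  case True
  then show ?thesis by (simp add: q_map_def closest_point_self)
next
  case False
  have "(1 / (2 * norm p)) *\<^sub>R p = closest_point (cball 0 (1 / 2)) p"
  proof (rule closest_point_unique)
    show "(1 / (2 * norm p)) *\<^sub>R p \<in> cball 0 (1 / 2)" using False by (simp add: field_simps)
    show "\<forall>z\<in>cball 0 (1 / 2). dist p ((1 / (2 * norm p)) *\<^sub>R p) \<le> dist p z"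
    proof
      fix z :: "real^2" assume "z \<in> cball 0 (1 / 2)"
      \<comment> \<open>The reverse triangle inequality bounds every distance from below; the radial
        rescaling of \<open>p\<close> attains the bound.\<close>
      then have "norm p - 1 / 2 \<le> dist p z"
        using norm_triangle_ineq2[of p z] by (simp add: dist_norm)
      moreover have "dist p ((1 / (2 * norm p)) *\<^sub>R p) = norm p - 1 / 2"
      proof -
        have "p \<noteq> 0" using False by auto
        have "p - (1 / (2 * norm p)) *\<^sub>R p = (1 - 1 / (2 * norm p)) *\<^sub>R p"
          by (simp add: scaleR_left_diff_distrib)
        moreover have "1 - 1 / (2 * norm p) \<ge> 0" using False by (simp add: divide_le_eq)
        ultimately have "dist p ((1 / (2 * norm p)) *\<^sub>R p) = (1 - 1 / (2 * norm p)) * norm p"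
          by (simp add: dist_norm)
        also have "\<dots> = norm p - 1 / 2" using \<open>p \<noteq> 0\<close> by (simp add: field_simps)
        finally show ?thesis .
      qed
      ultimately show "dist p ((1 / (2 * norm p)) *\<^sub>R p) \<le> dist p z" by simp
    qed
  qed auto
  from this[symmetric] show ?thesis using False by (simp add: q_map_def inverse_eq_divide)
qed

lemma q_map_lipschitz: "norm (q_map p - q_map p') \<le> 2 * norm (p - p')"
proof -
  have "dist (closest_point (cball 0 (1 / 2)) p) (closest_point (cball 0 (1 / 2)) p') \<le> dist p p'"
    by (intro closest_point_lipschitz) auto
  then show ?thesis
    by (simp add: q_map_closest_point dist_norm flip: scaleR_right_diff_distrib)
qed

lemma a_coef_lipschitz: "\<bar>a_coef i p - a_coef i p'\<bar> \<le> 2 * norm (p - p')"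
proof -
  have "\<bar>a_coef i p - a_coef i p'\<bar> = \<bar>adir i \<bullet> (q_map p - q_map p')\<bar>"
    by (simp add: a_coef_adir inner_diff_right)
  also have "\<dots> \<le> norm (adir i) * norm (q_map p - q_map p')"
    by (rule Cauchy_Schwarz_ineq2)
  finally show ?thesis using q_map_lipschitz[of p p'] by (simp add: norm_adir)
qed

section \<open>Lipschitz continuity and semialgebraicity of the objective\<close>

lemma locally_lipschitz_f_obj: "locally_lipschitz f_obj"
  unfolding locally_lipschitz_def
proof
  fix x :: "(real^2) \<times> (real^4)"
  define B where "B = norm x + 1"
  \<comment> \<open>Four summands, each with constant \<open>2 * B + 3\<close>: the coefficient
    varies at rate 2 against \<open>\<bar>z $ i\<bar> \<le> B\<close>, and is at most 3 against a
    1-Lipschitz absolute value.\<close>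
  have "(8 * B + 12)-lipschitz_on (cball x 1) f_obj"
  proof (rule lipschitz_onI)
    fix y y' :: "(real^2) \<times> (real^4)"
    assume y: "y \<in> cball x 1" "y' \<in> cball x 1"
    obtain p z p' z' where e: "y = (p, z)" "y' = (p', z')" by fastforce
    have "norm y \<le> B"
      using y(1) norm_triangle_ineq2[of y x] by (simp add: B_def dist_norm norm_minus_commute)
    then have "norm z \<le> B" using norm_snd_le[of z p] by (simp add: e)
    have d: "norm (p - p') \<le> dist y y'" "norm (z - z') \<le> dist y y'"
      using norm_fst_le[of "p - p'" "z - z'"] norm_snd_le[of "z - z'" "p - p'"]
      by (auto simp: e dist_norm)
    have summand: "\<bar>a_coef i p * \<bar>z $ i\<bar> - a_coef i p' * \<bar>z' $ i\<bar>\<bar> \<le> (2 * B + 3) * dist y y'" for i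
    proof -
      have "a_coef i p * \<bar>z $ i\<bar> - a_coef i p' * \<bar>z' $ i\<bar>
        = (a_coef i p - a_coef i p') * \<bar>z $ i\<bar> + a_coef i p' * (\<bar>z $ i\<bar> - \<bar>z' $ i\<bar>)"
        by (simp add: algebra_simps)
      then have "\<bar>a_coef i p * \<bar>z $ i\<bar> - a_coef i p' * \<bar>z' $ i\<bar>\<bar>
        \<le> \<bar>a_coef i p - a_coef i p'\<bar> * \<bar>z $ i\<bar> + a_coef i p' * \<bar>\<bar>z $ i\<bar> - \<bar>z' $ i\<bar>\<bar>"
        using abs_triangle_ineq[of "(a_coef i p - a_coef i p') * \<bar>z $ i\<bar>" "a_coef i p' * (\<bar>z $ i\<bar> - \<bar>z' $ i\<bar>)"]
          a_coef_bounds(1)[of i p'] by (simp add: abs_mult)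
      also have "\<dots> \<le> (2 * dist y y') * B + 3 * dist y y'"
      proof (intro add_mono mult_mono)
        show "\<bar>a_coef i p - a_coef i p'\<bar> \<le> 2 * dist y y'"
          using a_coef_lipschitz[of i p p'] d(1) by linarith
        show "\<bar>z $ i\<bar> \<le> B" using component_le_norm_cart[of z i] \<open>norm z \<le> B\<close> by linarith
        show "\<bar>\<bar>z $ i\<bar> - \<bar>z' $ i\<bar>\<bar> \<le> dist y y'"
          using component_le_norm_cart[of "z - z'" i] d(2) by simp
      qed (use a_coef_bounds in auto)
      finally show ?thesis by (simp add: algebra_simps)
    qed
    have "dist (f_obj y) (f_obj y') = \<bar>\<Sum>i\<in>UNIV. a_coef i p * \<bar>z $ i\<bar> - a_coef i p' * \<bar>z' $ i\<bar>\<bar>"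
      by (simp add: f_obj_def e dist_real_def sum_subtractf)
    also have "\<dots> \<le> (\<Sum>i\<in>(UNIV::4 set). (2 * B + 3) * dist y y')"
      by (intro order_trans[OF sum_abs] sum_mono summand)
    finally show "dist (f_obj y) (f_obj y') \<le> (8 * B + 12) * dist y y'"
      by (simp add: algebra_simps)
  qed (simp add: B_def)
  then show "\<exists>u>0. \<exists>L. L-lipschitz_on (cball x u) f_obj" by (intro exI[of _ 1]) auto
qed

lemma f_obj_le: "\<bar>f_obj (p, z)\<bar> \<le> 12 * norm z"
proof -
  have "\<bar>f_obj (p, z)\<bar> \<le> (\<Sum>i\<in>(UNIV::4 set). 3 * norm z)"
    unfolding f_obj_def prod.case
  proof (intro order_trans[OF sum_abs] sum_mono)
    fix i
    have "\<bar>a_coef i p * \<bar>z $ i\<bar>\<bar> = a_coef i p * \<bar>z $ i\<bar>"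
      using a_coef_bounds(1)[of i p] by (simp add: abs_mult)
    also have "\<dots> \<le> 3 * norm z"
      using a_coef_bounds[of i p] component_le_norm_cart[of z i] by (intro mult_mono) auto
    finally show "\<bar>a_coef i p * \<bar>z $ i\<bar>\<bar> \<le> 3 * norm z" .
  qed
  then show ?thesis by simp
qed

text \<open>The graph splits along the small disc, given by \<open>N w \<le> 1 / 4\<close>: inside,
  \<open>t = 2 S + 2 L\<close>; outside, \<open>t = 2 S + L / norm p\<close>. Here \<open>S\<close>,
  \<open>L\<close> and \<open>N\<close> are piecewise polynomial.\<close>

lemma semialgebraic_f_obj: "semialgebraic_function f_obj"
proof -
  define p where "p j w = fst (fst w) $ j" for j and w :: "((real^2) \<times> (real^4)) \<times> real"
  define z where "z i w = snd (fst w) $ i" for i and w :: "((real^2) \<times> (real^4)) \<times> real"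
  define t where "t w = snd w" for w :: "((real^2) \<times> (real^4)) \<times> real"
  define S where "S w = \<bar>z 1 w\<bar> + \<bar>z 2 w\<bar> + \<bar>z 3 w\<bar> + \<bar>z 4 w\<bar>" for w
  define L where "L w = p 1 w * (\<bar>z 1 w\<bar> - \<bar>z 2 w\<bar>) + p 2 w * (\<bar>z 3 w\<bar> - \<bar>z 4 w\<bar>)" for w
  define N where "N w = p 1 w * p 1 w + p 2 w * p 2 w" for w
  have bl: "bounded_linear (p j)" "bounded_linear (z i)" "bounded_linear t" for i j
    unfolding p_def z_def t_def
    by (intro bounded_linear_compose[OF bounded_linear_vec_nth]
        bounded_linear_compose[OF bounded_linear_fst] bounded_linear_compose[OF bounded_linear_snd]
        bounded_linear_fst bounded_linear_snd)+
  have pw: "pwpoly (p j)" "pwpoly (z i)" "pwpoly t" for i j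
    using bl by (auto intro: pwpoly_linear)
  have pwS: "pwpoly S" and pwL: "pwpoly L" and pwN: "pwpoly N"
    unfolding S_def L_def N_def
    by (intro pwpoly_add pwpoly_mult pwpoly_diff pwpoly_abs pw)+
  have N: "norm (fst (fst w)) ^ 2 = N w" for w
    by (simp add: N_def p_def power2_norm_eq_inner inner_vec_def sum_2)
  have small: "N w \<le> 1 / 4 \<longleftrightarrow> norm (fst (fst w)) \<le> 1 / 2" for w
    using abs_le_square_iff[of "norm (fst (fst w))" "1 / 2"] by (simp add: N[symmetric] power_divide)
  have f: "f_obj (fst w) = (if N w \<le> 1 / 4 then 2 * S w + 2 * L w
      else 2 * S w + L w / norm (fst (fst w)))" for w
  proof -
    have "f_obj (fst w) = (\<Sum>i\<in>UNIV. a_coef i (fst (fst w)) * \<bar>snd (fst w) $ i\<bar>)"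
      by (simp add: f_obj_def case_prod_beta)
    also have "\<dots> = 2 * S w + q_map (fst (fst w)) $ 1 * (\<bar>z 1 w\<bar> - \<bar>z 2 w\<bar>)
      + q_map (fst (fst w)) $ 2 * (\<bar>z 3 w\<bar> - \<bar>z 4 w\<bar>)"
      by (simp add: sum_4 a_coef_def S_def z_def algebra_simps)
    finally have e: "f_obj (fst w) = 2 * S w + q_map (fst (fst w)) $ 1 * (\<bar>z 1 w\<bar> - \<bar>z 2 w\<bar>)
      + q_map (fst (fst w)) $ 2 * (\<bar>z 3 w\<bar> - \<bar>z 4 w\<bar>)" .
    have "q_map (fst (fst w)) $ j =
        (if N w \<le> 1 / 4 then 2 * p j w else inverse (norm (fst (fst w))) * p j w)" for j
      unfolding small by (simp add: q_map_def p_def)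
    note q = this[of 1] this[of 2]
    have l: "S' + (c * a) * u + (c * b) * v = S' + c * (a * u + b * v)" for S' a b c u v :: real
      by (simp only: distrib_left mult.assoc add.assoc)
    show ?thesis
    proof (cases "N w \<le> 1 / 4")
      case True
      show ?thesis unfolding e q if_P[OF True] l L_def ..
    next
      case False
      show ?thesis unfolding e q if_not_P[OF False] l L_def by (simp only: divide_inverse mult.commute)
    qed
  qed
  \<comment> \<open>Squaring removes the norm, a square root; the sign condition makes this an equivalence.\<close>
  have pos: "t w = 2 * S w + L w / norm (fst (fst w)) \<longleftrightarrow>
      (t w - 2 * S w) * (t w - 2 * S w) * N w = L w * L w \<and> 0 \<le> (t w - 2 * S w) * L w"
    if "\<not> N w \<le> 1 / 4" for w
  proof -
    define n where "n = norm (fst (fst w))"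
    define c where "c = t w - 2 * S w"
    have n: "n > 0" using that small[of w] by (auto simp: n_def)
    have "t w = 2 * S w + L w / n \<longleftrightarrow> c * n = L w"
      using n by (auto simp: c_def field_simps)
    also have "\<dots> \<longleftrightarrow> (c * n)^2 = (L w)^2 \<and> 0 \<le> (c * n) * L w"
    proof
      assume "(c * n)^2 = (L w)^2 \<and> 0 \<le> (c * n) * L w"
      then have "c * n = L w \<or> c * n = - L w" "0 \<le> (c * n) * L w"
        by (simp_all only: power2_eq_iff)
      then show "c * n = L w"
        using not_real_square_gt_zero[of "L w"] by (auto simp: mult_le_0_iff)
    qed simp
    also have "0 \<le> (c * n) * L w \<longleftrightarrow> 0 \<le> c * L w"
    proof -
      have "(c * n) * L w = n * (c * L w)" by simp
      then show ?thesis using mult_le_cancel_left_pos[OF n, of 0 "c * L w"] by (simp only: mult_zero_right)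
    qed
    also have "(c * n)^2 = c * c * N w"
      by (simp add: N[of w, folded n_def, symmetric] power2_eq_square)
    finally show ?thesis by (simp add: n_def c_def power2_eq_square)
  qed
  have "{(x, t). t = f_obj x} = {w. t w = f_obj (fst w)}"
    by (auto simp: t_def)
  also have "\<dots> = ({w. N w \<le> 1 / 4} \<inter> {w. t w = 2 * S w + 2 * L w})
    \<union> (- {w. N w \<le> 1 / 4} \<inter> ({w. (t w - 2 * S w) * (t w - 2 * S w) * N w = L w * L w}
        \<inter> {w. 0 \<le> (t w - 2 * S w) * L w}))" (is "_ = ?R")
  proof (rule set_eqI)
    fix w
    show "w \<in> {w. t w = f_obj (fst w)} \<longleftrightarrow> w \<in> ?R"
      using pos[of w] by (cases "N w \<le> 1 / 4") (simp_all only: f if_True if_False mem_Collect_eq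
        Un_iff Int_iff Compl_iff simp_thms)
  qed
  finally have graph: "{(x, t). t = f_obj x} = ?R" .
  show ?thesis
    unfolding semialgebraic_function_def graph
    by (intro semialgebraic_set.Un semialgebraic_set_Int semialgebraic_set.Compl
        semialgebraic_set_pwpoly_eq semialgebraic_set_pwpoly_le;
      intro pwpoly_add pwpoly_mult pwpoly_diff pwpoly_const pw pwS pwL pwN)
qed

section \<open>Derivatives of the coefficients and subgradients of the objective\<close>

text \<open>On the open set \<open>1 / 2 < norm p\<close> the coefficient is
  \<open>2 + (adir i \<bullet> p) / norm p\<close>, homogeneous of degree 0. Its gradient is
  therefore the part of \<open>adir i\<close> orthogonal to \<open>p\<close>, over
  \<open>norm p\<close>.\<close>

lemma has_derivative_a_coef:
  assumes p: "1 / 2 < norm p"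
  shows "(a_coef i has_derivative
    (\<lambda>d. ((adir i - (adir i \<bullet> sgn p) *\<^sub>R sgn p) /\<^sub>R norm p) \<bullet> d)) (at p)"
proof -
  have "p \<noteq> 0" using p by auto
  have der: "((\<lambda>p. 2 + (adir i \<bullet> p) / norm p) has_derivative
    (\<lambda>d. ((adir i - (adir i \<bullet> sgn p) *\<^sub>R sgn p) /\<^sub>R norm p) \<bullet> d)) (at p)"
  proof (rule has_derivative_eq_rhs)
    show "((\<lambda>p. 2 + (adir i \<bullet> p) / norm p) has_derivative (\<lambda>d. 0 +
        ((adir i \<bullet> d) * norm p - (adir i \<bullet> p) * (sgn p \<bullet> d)) / (norm p * norm p))) (at p)"
      using has_derivative_norm[OF \<open>p \<noteq> 0\<close>] \<open>p \<noteq> 0\<close>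
      by (intro has_derivative_add[OF has_derivative_const] has_derivative_divide'
          bounded_linear_imp_has_derivative[OF bounded_linear_inner_right]) (simp_all add: inner_commute)
  qed (use \<open>p \<noteq> 0\<close> in \<open>simp add: fun_eq_iff sgn_div_norm inner_diff_left field_simps\<close>)
  have op: "open {p::real^2. 1 / 2 < norm p}"
    by (intro open_Collect_less continuous_intros)
  have eq: "2 + (adir i \<bullet> p) / norm p = a_coef i p" if "1 / 2 < norm p" for p
    using that by (simp add: a_coef_adir q_map_def) (simp only: divide_inverse mult.commute)
  show ?thesis
    by (rule has_derivative_transform_within_open[OF der op]) (simp_all only: p eq mem_Collect_eq)
qed

text \<open>The smooth minorant is \<open>s * a_coef i p * z $ i\<close>, the other summands being
  nonnegative: \<open>\<bar>s\<bar> \<le> 1\<close> keeps it below \<open>f_obj\<close>, and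
  \<open>s * \<zeta> = \<bar>\<zeta>\<bar>\<close> makes it touch. At \<open>\<zeta> = 0\<close>
  every such \<open>s\<close> qualifies, which is the freedom used to leave the critical
  set.\<close>

lemma clarke_subdifferential_f_obj:
  assumes p: "1 / 2 < norm p" and s: "\<bar>s\<bar> \<le> 1" "s * \<zeta> = \<bar>\<zeta>\<bar>"
  shows "(\<bar>\<zeta>\<bar> *\<^sub>R ((adir i - (adir i \<bullet> sgn p) *\<^sub>R sgn p) /\<^sub>R norm p), axis i (s * a_coef i p))
    \<in> clarke_subdifferential f_obj (p, axis i \<zeta>)"
proof (rule clarke_subdifferential_minorant)
  let ?g = "\<lambda>x :: (real^2) \<times> (real^4). s * (a_coef i (fst x) * (snd x $ i))"
  show "?g y \<le> f_obj y" for y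
  proof -
    have "s * snd y $ i \<le> \<bar>snd y $ i\<bar>"
      using abs_ge_self[of "s * snd y $ i"] mult_right_mono[OF s(1) abs_ge_zero, of "snd y $ i"]
      by (simp only: abs_mult mult_1)
    then have "?g y \<le> a_coef i (fst y) * \<bar>snd y $ i\<bar>"
      using mult_left_mono[of "s * snd y $ i" "\<bar>snd y $ i\<bar>" "a_coef i (fst y)"]
        a_coef_bounds(1)[of i "fst y"] by (simp add: algebra_simps)
    also have "\<dots> \<le> (\<Sum>i\<in>UNIV. a_coef i (fst y) * \<bar>snd y $ i\<bar>)"
      by (rule member_le_sum)
        (auto intro!: mult_nonneg_nonneg order_trans[OF zero_le_one a_coef_bounds(1)])
    finally show ?thesis by (simp add: f_obj_def case_prod_beta)
  qed
  show "?g (p, axis i \<zeta>) = f_obj (p, axis i \<zeta>)"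
  proof -
    have "f_obj (p, axis i \<zeta>) = (\<Sum>j\<in>UNIV. if j = i then a_coef i p * \<bar>\<zeta>\<bar> else 0)"
      unfolding f_obj_def prod.case by (rule sum.cong) (auto simp: axis_def)
    also have "\<dots> = a_coef i p * \<bar>\<zeta>\<bar>" by simp
    finally show ?thesis using s(2) by (simp add: mult.left_commute)
  qed
  have fst: "((\<lambda>x :: (real^2) \<times> (real^4). a_coef i (fst x)) has_derivative
    (\<lambda>x. ((adir i - (adir i \<bullet> sgn p) *\<^sub>R sgn p) /\<^sub>R norm p) \<bullet> fst x)) (at (p, axis i \<zeta>))"
    by (rule has_derivative_compose[where f = fst and g = "a_coef i"])
      (simp_all only: fst_conv has_derivative_a_coef[OF p] bounded_linear_imp_has_derivative[OF bounded_linear_fst])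
  have snd: "((\<lambda>x :: (real^2) \<times> (real^4). snd x $ i) has_derivative (\<lambda>x. snd x $ i)) (at (p, axis i \<zeta>))"
    by (intro bounded_linear_imp_has_derivative bounded_linear_compose[OF bounded_linear_vec_nth]
      bounded_linear_snd)
  show "(?g has_derivative (\<lambda>d. (\<bar>\<zeta>\<bar> *\<^sub>R ((adir i - (adir i \<bullet> sgn p) *\<^sub>R sgn p) /\<^sub>R norm p),
    axis i (s * a_coef i p)) \<bullet> d)) (at (p, axis i \<zeta>))"
  proof (rule has_derivative_eq_rhs[OF has_derivative_mult_right[OF has_derivative_mult[OF fst snd]]], rule ext)
    fix d :: "(real^2) \<times> (real^4)"
    have "s * (a * y + x * \<zeta>) = \<bar>\<zeta>\<bar> * x + s * a * y" for a x y :: real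
      unfolding s(2)[symmetric] by (simp add: distrib_left)
    then show "s * (a_coef i (fst (p, axis i \<zeta>)) * snd d $ i
        + ((adir i - (adir i \<bullet> sgn p) *\<^sub>R sgn p) /\<^sub>R norm p) \<bullet> fst d * snd (p, axis i \<zeta>) $ i)
      = (\<bar>\<zeta>\<bar> *\<^sub>R ((adir i - (adir i \<bullet> sgn p) *\<^sub>R sgn p) /\<^sub>R norm p), axis i (s * a_coef i p)) \<bullet> d"
      unfolding inner_prod_def inner_axis' fst_conv snd_conv inner_scaleR_left[of "\<bar>\<zeta>\<bar>"] axis_nth
      by (simp only: inner_real_def)
  qed
qed

section \<open>Polar coordinates in the plane\<close>

definition radial :: "real \<Rightarrow> real^2" where
  "radial \<theta> = vector [cos \<theta>, sin \<theta>]"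

definition tangent :: "real \<Rightarrow> real^2" where
  "tangent \<theta> = vector [- sin \<theta>, cos \<theta>]"

lemma norm_radial: "norm (radial \<theta>) = 1"
  by (simp add: radial_def norm_eq_1 inner_vec_def sum_2)

text \<open>\<open>radial\<close> and \<open>tangent\<close> form an orthonormal basis. This turns
  the gradient of a coefficient into a multiple of \<open>tangent\<close>.\<close>

lemma orthonormal_expansion: "v - (v \<bullet> radial \<theta>) *\<^sub>R radial \<theta> = (v \<bullet> tangent \<theta>) *\<^sub>R tangent \<theta>"
proof -
  have c: "cos \<theta> * cos \<theta> = 1 - sin \<theta> * sin \<theta>"
    using sin_cos_squared_add[of \<theta>] by (simp add: power2_eq_square)
  have "x - (x * cos \<theta> + y * sin \<theta>) * cos \<theta> = - ((y * cos \<theta> - x * sin \<theta>) * sin \<theta>)"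
    "y - (x * cos \<theta> + y * sin \<theta>) * sin \<theta> = (y * cos \<theta> - x * sin \<theta>) * cos \<theta>" for x y
    using c by algebra+
  then show ?thesis
    by (simp add: vec_eq_iff forall_2 radial_def tangent_def inner_vec_def sum_2)
qed

text \<open>A right triangle with legs 1 and \<open>h\<close>: a tangential move of relative length
  \<open>h\<close> stretches the radius by \<open>sqrt (1 + h\<^sup>2)\<close> and turns by
  \<open>arctan h\<close>.\<close>

lemma radial_add_arctan:
  "sqrt (1 + h\<^sup>2) *\<^sub>R radial (\<theta> + arctan h) = radial \<theta> + h *\<^sub>R tangent \<theta>"
proof -
  have "sqrt (1 + h\<^sup>2) \<noteq> 0"
    by (metis add_pos_nonneg less_irrefl real_sqrt_gt_zero zero_le_power2 zero_less_one)
  then show ?thesis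
    by (simp add: vec_eq_iff forall_2 radial_def tangent_def cos_add sin_add cos_arctan sin_arctan
        distrib_left right_diff_distrib)
qed

lemma ex_radial: "\<exists>\<phi>. p = norm p *\<^sub>R radial \<phi>"
proof (cases "p = 0")
  case False
  have "(p $ 1 / norm p)\<^sup>2 + (p $ 2 / norm p)\<^sup>2 = 1"
  proof -
    have "(norm p)\<^sup>2 = (p $ 1)\<^sup>2 + (p $ 2)\<^sup>2"
      unfolding power2_norm_eq_inner by (simp add: inner_vec_def sum_2 power2_eq_square)
    from this[symmetric] show ?thesis
      using False unfolding power_divide add_divide_distrib[symmetric] by simp
  qed
  then obtain \<phi> where "p $ 1 / norm p = cos \<phi>" "p $ 2 / norm p = sin \<phi>"
    by (rule sincos_total_2pi)
  then have "p $ 1 = norm p * cos \<phi>" "p $ 2 = norm p * sin \<phi>"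
    using False by (simp_all add: field_simps)
  then show ?thesis
    by (intro exI[of _ \<phi>]) (simp add: vec_eq_iff forall_2 radial_def)
qed simp

lemma continuous_radial: "continuous_on UNIV radial"
proof -
  have "radial = (\<lambda>\<theta>. cos \<theta> *\<^sub>R axis 1 1 + sin \<theta> *\<^sub>R axis 2 1)"
    by (simp add: fun_eq_iff vec_eq_iff forall_2 radial_def axis_def)
  moreover have "continuous_on UNIV (\<lambda>\<theta>. cos \<theta> *\<^sub>R axis 1 1 + sin \<theta> *\<^sub>R axis 2 1 :: real^2)"
    by (intro continuous_intros)
  ultimately show ?thesis by (simp only:)
qed

lemma radial_periodic: "radial (\<phi> + 2 * pi * real n) = radial \<phi>"
proof -
  have "2 * pi * real n = 2 * real n * pi" by simp
  then show ?thesis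
    unfolding radial_def cos_add sin_add by (simp only: cos_2npi sin_2npi) simp
qed

text \<open>On \<open>[0, 3]\<close> the derivative \<open>1 / (1 + y\<^sup>2)\<close> is at least
  1/10.\<close>

lemma arctan_ge: "x / 10 \<le> arctan x" if "0 \<le> x" "x \<le> 3" for x :: real
proof -
  have "arctan 0 - 0 / 10 \<le> arctan x - x / 10"
  proof (rule DERIV_nonneg_imp_nondecreasing[OF that(1)])
    fix y :: real assume y: "0 \<le> y" "y \<le> x"
    have "y\<^sup>2 \<le> 3\<^sup>2" using y that by (intro power_mono) auto
    then have "0 \<le> inverse (1 + y\<^sup>2) - 1 / 10"
      by (simp add: field_simps add_pos_nonneg)
    moreover have "((\<lambda>x. arctan x - x / 10) has_real_derivative inverse (1 + y\<^sup>2) - 1 / 10) (at y)"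
      by (auto intro!: derivative_eq_intros)
    ultimately show "\<exists>z. ((\<lambda>x. arctan x - x / 10) has_real_derivative z) (at y) \<and> 0 \<le> z" by blast
  qed
  then show ?thesis by simp
qed

section \<open>The coefficient that turns \<open>p\<close> counterclockwise\<close>

text \<open>The four products are plus and minus \<open>sin \<theta>\<close> and
  \<open>cos \<theta>\<close>, which cannot both be below 1/2 in modulus. The sign is negative
  because a subgradient step subtracts the gradient.\<close>

lemma ex_adir_tangent: "\<exists>i. adir i \<bullet> tangent \<theta> \<le> - 1 / 2"
proof (rule ccontr)
  assume "\<not> ?thesis"
  then have n: "adir i \<bullet> tangent \<theta> > - 1 / 2" for i
    by (meson not_le)
  have "\<bar>sin \<theta>\<bar> < 1 / 2" "\<bar>cos \<theta>\<bar> < 1 / 2"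
    using n[of 1] n[of 2] n[of 3] n[of 4] by (auto simp: adir_def tangent_def inner_axis')
  then have "\<bar>sin \<theta>\<bar>\<^sup>2 \<le> (1 / 2)\<^sup>2" "\<bar>cos \<theta>\<bar>\<^sup>2 \<le> (1 / 2)\<^sup>2"
    by (intro power_mono; simp)+
  then show False
    using sin_cos_squared_add[of \<theta>] by (simp add: power2_eq_square)
qed

definition push :: "real \<Rightarrow> 4" where
  "push \<theta> = (SOME i. adir i \<bullet> tangent \<theta> \<le> - 1 / 2)"

text \<open>At radius \<open>r\<close> and step size \<open>\<alpha>\<close>, the return to
  \<open>z = 0\<close> moves \<open>p\<close> along \<open>tangent\<close> by
  \<open>\<alpha>\<^sup>2 * gain \<theta> / r\<close>.\<close>

definition gain :: "real \<Rightarrow> real" where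
  "gain \<theta> = - (adir (push \<theta>) \<bullet> tangent \<theta>) * (2 + adir (push \<theta>) \<bullet> radial \<theta>)"

text \<open>The two factors lie in \<open>[1 / 2, 1]\<close> and \<open>[1, 3]\<close>. The lower
  bound will drive the angle to infinity, the upper one will keep the radius bounded.\<close>

lemma gain_bounds: "1 / 2 \<le> gain \<theta>" "gain \<theta> \<le> 3"
proof -
  let ?t = "- (adir (push \<theta>) \<bullet> tangent \<theta>)" and ?a = "2 + adir (push \<theta>) \<bullet> radial \<theta>"
  have "\<bar>adir (push \<theta>) \<bullet> radial \<theta>\<bar> \<le> 1"
    using Cauchy_Schwarz_ineq2[of "adir (push \<theta>)" "radial \<theta>"] by (simp add: norm_adir norm_radial)
  then have a: "1 \<le> ?a" "?a \<le> 3" by linarith+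
  have "norm (tangent \<theta>) = 1"
    by (simp add: tangent_def norm_eq_1 inner_vec_def sum_2 add.commute)
  then have t: "?t \<le> 1"
    using Cauchy_Schwarz_ineq2[of "adir (push \<theta>)" "tangent \<theta>"] by (simp add: norm_adir)
  have "1 / 2 \<le> ?t"
    using someI_ex[OF ex_adir_tangent[of \<theta>]] unfolding push_def by linarith
  with a t show "1 / 2 \<le> gain \<theta>" "gain \<theta> \<le> 3"
    using mult_mono[of "1 / 2" ?t 1 ?a] mult_mono[of ?t 1 ?a 3] unfolding gain_def by linarith+
qed

section \<open>Radii and angles of the spiral\<close>

context
  fixes K :: real
  assumes K: "K \<ge> 1"
begin

text \<open>Stage \<open>m\<close> stands for two subgradient steps; \<open>p\<close> moves only in
  the second, whose squared step size is \<open>1 / (2 m + 1 + K)\<close>. One factor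
  \<open>r\<close> in the denominator comes from the gradient, the other makes the move relative to
  the radius. Angles are not reduced modulo a full turn.\<close>

primrec polar :: "nat \<Rightarrow> real \<times> real" where
  "polar 0 = (1, 0)"
| "polar (Suc m) = (let (r, \<theta>) = polar m; h = gain \<theta> / ((2 * real m + 1 + K) * r\<^sup>2)
     in (r * sqrt (1 + h\<^sup>2), \<theta> + arctan h))"

definition rad :: "nat \<Rightarrow> real" where "rad m = fst (polar m)"

definition ang :: "nat \<Rightarrow> real" where "ang m = snd (polar m)"

definition slope :: "nat \<Rightarrow> real" where
  "slope m = gain (ang m) / ((2 * real m + 1 + K) * (rad m)\<^sup>2)"

definition spiral :: "nat \<Rightarrow> real^2" where
  "spiral m = rad m *\<^sub>R radial (ang m)"

lemma rad_0: "rad 0 = 1"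
  by (simp add: rad_def)

lemma rad_Suc: "rad (Suc m) = rad m * sqrt (1 + (slope m)\<^sup>2)"
  by (simp add: rad_def ang_def slope_def case_prod_beta Let_def)

lemma ang_Suc: "ang (Suc m) = ang m + arctan (slope m)"
  by (simp add: rad_def ang_def slope_def case_prod_beta Let_def)

lemma rad_le_Suc: "0 \<le> rad m \<Longrightarrow> rad m \<le> rad (Suc m)"
  using mult_left_mono[of 1 "sqrt (1 + (slope m)\<^sup>2)" "rad m"] by (simp add: rad_Suc)

lemma rad_ge_1: "1 \<le> rad m"
proof (induction m)
  case (Suc m)
  then show ?case using rad_le_Suc[of m] by linarith
qed (simp add: rad_0)

lemma incseq_rad: "incseq rad"
  by (intro incseq_SucI rad_le_Suc order_trans[OF zero_le_one rad_ge_1])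

lemma slope_pos: "0 < slope m"
  unfolding slope_def using gain_bounds(1)[of "ang m"] rad_ge_1[of m] K
  by (intro divide_pos_pos mult_pos_pos zero_less_power) auto

text \<open>This product is the length of the displacement of \<open>p\<close> at stage
  \<open>m\<close>; \<open>K \<ge> 1\<close> gives
  \<open>2 m + 1 + K \<ge> 2 (m + 1)\<close>.\<close>

lemma slope_times_rad: "slope m * rad m \<le> 3 / (2 * (real m + 1))"
proof -
  have "slope m * rad m = gain (ang m) / ((2 * real m + 1 + K) * rad m)"
    using rad_ge_1[of m] by (simp add: slope_def power2_eq_square)
  also have "\<dots> \<le> 3 / ((2 * (real m + 1)) * 1)"
    using gain_bounds(2)[of "ang m"] gain_bounds(1)[of "ang m"] rad_ge_1[of m] K
    by (intro frac_le mult_mono) auto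
  finally show ?thesis by simp
qed

text \<open>By Pythagoras the increment is at most \<open>9 / (4 (m + 1)\<^sup>2)\<close>, hence at
  most \<open>9 / ((m + 1) (m + 2))\<close>, which telescopes. The constant 10 makes the bound equal
  to 1 at \<open>m = 0\<close>.\<close>

lemma rad_square_le: "(rad m)\<^sup>2 \<le> 10 - 9 / (real m + 1)"
proof (induction m)
  case (Suc m)
  have "(rad (Suc m))\<^sup>2 = (rad m)\<^sup>2 + (slope m * rad m)\<^sup>2"
    by (simp add: rad_Suc power_mult_distrib algebra_simps)
  also have "(slope m * rad m)\<^sup>2 \<le> (3 / (2 * (real m + 1)))\<^sup>2"
    using slope_times_rad[of m] slope_pos[of m] rad_ge_1[of m] by (intro power_mono) auto
  also have "(3 / (2 * (real m + 1)))\<^sup>2 \<le> 9 / (real m + 1) - 9 / (real (Suc m) + 1)"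
    by (simp add: divide_simps power2_eq_square) (simp add: algebra_simps)
  finally show ?case using Suc.IH by linarith
qed (simp add: rad_0)

lemma rad_square_le_10: "(rad m)\<^sup>2 \<le> 10"
  using rad_square_le[of m] divide_nonneg_nonneg[of 9 "real m + 1"] by linarith

lemma rad_le: "rad m \<le> 4"
  using rad_square_le_10[of m] power2_le_imp_le[of "rad m" 4] by simp

lemma slope_le: "slope m \<le> 3 / (2 * (real m + 1))"
proof -
  have "slope m * 1 \<le> slope m * rad m"
    using slope_pos[of m] rad_ge_1[of m] by (intro mult_left_mono) auto
  then show ?thesis using slope_times_rad[of m] by simp
qed

text \<open>The factor 200 is 2 * 10 * 10, from \<open>gain \<theta> \<ge> 1 / 2\<close>,
  \<open>(rad m)\<^sup>2 \<le> 10\<close> and \<open>arctan_ge\<close>.\<close>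

lemma arctan_slope_ge: "1 / (200 * (2 + K)) * (1 / (real m + 1)) \<le> arctan (slope m)"
proof -
  have "1 / (200 * (2 + K)) * (1 / (real m + 1)) = (1 / 2) / (((2 + K) * (real m + 1)) * 10) / 10"
    by (simp add: field_simps)
  also have "\<dots> \<le> slope m / 10"
    unfolding slope_def
  proof (intro divide_right_mono frac_le mult_mono mult_pos_pos)
    have "0 \<le> real m * K" using K by simp
    then show "2 * real m + 1 + K \<le> (2 + K) * (real m + 1)"
      by (simp add: algebra_simps)
  qed (use gain_bounds[of "ang m"] rad_square_le_10[of m] rad_ge_1[of m] K in \<open>auto intro: order_trans\<close>)
  also have "\<dots> \<le> arctan (slope m)"
  proof (rule arctan_ge)
    have "3 / (2 * (real m + 1)) \<le> 3" by (simp add: field_simps)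
    then show "slope m \<le> 3" using slope_le[of m] by linarith
  qed (use slope_pos[of m] in simp)
  finally show ?thesis .
qed

lemma ang_less_Suc: "ang m < ang (Suc m)"
  using slope_pos[of m] by (simp add: ang_Suc)

lemma strict_mono_ang: "strict_mono ang"
  using ang_less_Suc by (simp add: strict_mono_Suc_iff)

text \<open>An increment is below half of pi. Being shorter than a full turn, it cannot skip one,
  which later separates the indices chosen in successive turns.\<close>

lemma ang_Suc_less: "ang (Suc m) < ang m + 2"
  using arctan_ubound[of "slope m"] pi_less_4 by (simp add: ang_Suc)

text \<open>Summing the lower bounds on the increments compares the angle with the divergent
  harmonic series.\<close>

lemma filterlim_ang: "filterlim ang at_top sequentially"
proof -
  define c where "c = 1 / (200 * (2 + K))"
  have c: "c > 0" using K by (simp add: c_def)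
  have "c * harm m \<le> ang m" for m
  proof (induction m)
    case 0
    show ?case by (simp add: ang_def harm_def)
  next
    case (Suc m)
    have "c * harm (Suc m) = c * harm m + c * (1 / (real m + 1))"
      by (simp add: harm_Suc distrib_left inverse_eq_divide add.commute)
    then show ?case using Suc arctan_slope_ge[of m] by (simp add: ang_Suc c_def)
  qed
  moreover have "filterlim (\<lambda>m. c * harm m) at_top sequentially"
    using filterlim_tendsto_pos_mult_at_top[OF tendsto_const c harm_at_top] .
  ultimately show ?thesis
    using filterlim_at_top_mono always_eventually by blast
qed

lemma slope_tendsto_0: "slope \<longlonglongrightarrow> 0"
proof (rule tendsto_sandwich)
  show "\<forall>\<^sub>F n in sequentially. 0 \<le> slope n"
    using slope_pos by (intro always_eventually allI less_imp_le)
  show "\<forall>\<^sub>F n in sequentially. slope n \<le> (3 / 2) * inverse (real (Suc n))"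
    using slope_le by (intro always_eventually) (simp add: field_simps)
  show "(\<lambda>n. (3 / 2) * inverse (real (Suc n))) \<longlonglongrightarrow> 0"
    using tendsto_mult[OF tendsto_const LIMSEQ_inverse_real_of_nat] by fastforce
qed simp

lemma spiral_Suc: "spiral (Suc m) = spiral m + (rad m * slope m) *\<^sub>R tangent (ang m)"
  using arg_cong[OF radial_add_arctan[of "slope m" "ang m"], of "\<lambda>v. rad m *\<^sub>R v"]
  by (simp add: spiral_def rad_Suc ang_Suc scaleR_add_right)

lemma norm_spiral: "norm (spiral m) = rad m"
  using rad_ge_1[of m] by (simp add: spiral_def norm_radial)

lemma sgn_spiral: "sgn (spiral m) = radial (ang m)"
  using rad_ge_1[of m] by (simp add: spiral_def sgn_scaleR) (simp add: sgn_div_norm norm_radial)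

lemma a_coef_spiral: "a_coef i (spiral m) = 2 + adir i \<bullet> radial (ang m)"
proof -
  have "q_map (spiral m) = sgn (spiral m)"
    using rad_ge_1[of m] by (simp add: q_map_def norm_spiral sgn_div_norm)
  then show ?thesis by (simp only: a_coef_adir sgn_spiral)
qed

section \<open>Step sizes and iterates\<close>

definition step :: "nat \<Rightarrow> real" where
  "step k = (real k + K) powr (- (1 / 2))"

lemma step_pos: "0 < step k"
  using K by (simp add: step_def)

lemma step_Suc_le: "step (Suc k) \<le> step k"
  using K unfolding step_def by (intro powr_mono2') auto

lemma step_square: "step k * step k = 1 / (real k + K)"
proof -
  have "step k * step k = (real k + K) powr (- 1)"
    unfolding step_def powr_add[symmetric] by simp
  then show ?thesis using K by (simp add: powr_minus_divide)
qed

lemma step_tendsto_0: "step \<longlonglongrightarrow> 0"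
proof -
  have "filterlim (\<lambda>k. K + real k) at_top sequentially"
    by (rule filterlim_tendsto_add_at_top[OF tendsto_const filterlim_real_sequentially])
  then have "(\<lambda>k. (K + real k) powr (- (1 / 2))) \<longlonglongrightarrow> 0"
    by (intro tendsto_neg_powr) simp_all
  then show ?thesis by (simp only: step_def[abs_def] add.commute)
qed

text \<open>The height takes the size of the following step, at index \<open>2 m + 1\<close>, so
  that this step cancels it exactly.\<close>

definition lift :: "nat \<Rightarrow> real" where
  "lift m = step (Suc (2 * m)) * a_coef (push (ang m)) (spiral m)"

text \<open>At even indices the second component is \<open>axis _ 0 = 0\<close> whatever the index;
  writing it as an \<open>axis\<close> lets one subgradient lemma serve both parities.\<close>

definition iter :: "nat \<Rightarrow> (real^2) \<times> (real^4)" where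
  "iter k = (spiral (k div 2), axis (push (ang (k div 2))) (if even k then 0 else lift (k div 2)))"

text \<open>With \<open>\<zeta> = 0\<close> the \<open>p\<close>-component of the subgradient
  vanishes. The ratio \<open>?s\<close> trades the current step size for the next one, and is
  admissible because step sizes decrease.\<close>

lemma iter_even: "\<exists>v \<in> clarke_subdifferential f_obj (iter (2 * m)). iter (Suc (2 * m)) = iter (2 * m) - step (2 * m) *\<^sub>R v"
proof (rule bexI)
  let ?i = "push (ang m)" and ?s = "- (step (Suc (2 * m)) / step (2 * m))"
  have "1 / 2 < norm (spiral m)" using rad_ge_1[of m] by (simp add: norm_spiral)
  moreover have "\<bar>?s\<bar> \<le> 1"
    using step_pos[of "2 * m"] step_pos[of "Suc (2 * m)"] step_Suc_le[of "2 * m"] by simp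
  ultimately show "(0, axis ?i (?s * a_coef ?i (spiral m))) \<in> clarke_subdifferential f_obj (iter (2 * m))"
    using clarke_subdifferential_f_obj[of "spiral m" ?s 0 ?i] by (simp add: iter_def)
  show "iter (Suc (2 * m)) = iter (2 * m) - step (2 * m) *\<^sub>R (0, axis ?i (?s * a_coef ?i (spiral m)))"
    using step_pos[of "2 * m"] by (simp add: iter_def lift_def vec_eq_iff axis_def)
qed

text \<open>Here \<open>s = 1\<close> and \<open>\<zeta> = lift m\<close>. The
  \<open>z\<close>-component cancels, while the product of step size and height yields the squared
  step size in the motion of \<open>p\<close>.\<close>

lemma iter_odd: "\<exists>v \<in> clarke_subdifferential f_obj (iter (Suc (2 * m))).
  iter (Suc (Suc (2 * m))) = iter (Suc (2 * m)) - step (Suc (2 * m)) *\<^sub>R v"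
proof (rule bexI)
  let ?i = "push (ang m)" and ?t = "tangent (ang m)"
  let ?v = "lift m *\<^sub>R (((adir ?i \<bullet> ?t) *\<^sub>R ?t) /\<^sub>R rad m)" and ?a = "a_coef ?i (spiral m)"
  have p: "1 / 2 < norm (spiral m)" using rad_ge_1[of m] by (simp add: norm_spiral)
  have l: "0 \<le> lift m"
    using step_pos[of "Suc (2 * m)"] a_coef_bounds(1)[of ?i "spiral m"] by (simp add: lift_def)
  show "(?v, axis ?i ?a) \<in> clarke_subdifferential f_obj (iter (Suc (2 * m)))"
    using clarke_subdifferential_f_obj[OF p, of 1 "lift m" ?i] l
    by (simp add: iter_def sgn_spiral norm_spiral orthonormal_expansion)
  have "step (Suc (2 * m)) * lift m = ?a / (2 * real m + 1 + K)"
    using step_square[of "Suc (2 * m)"] by (simp add: lift_def add_ac flip: mult.assoc)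
  then have "step (Suc (2 * m)) *\<^sub>R ?v = (?a / (2 * real m + 1 + K) * inverse (rad m) * (adir ?i \<bullet> ?t)) *\<^sub>R ?t"
    by (simp only: scaleR_scaleR mult.assoc[symmetric])
  also have "?a / (2 * real m + 1 + K) * inverse (rad m) * (adir ?i \<bullet> ?t) = - (rad m * slope m)"
    using rad_ge_1[of m] by (simp add: slope_def gain_def a_coef_spiral power2_eq_square divide_inverse)
  finally have "spiral (Suc m) = spiral m - step (Suc (2 * m)) *\<^sub>R ?v"
    by (simp only: spiral_Suc scaleR_minus_left diff_minus_eq_add)
  \<comment> \<open>The active index changes between stages; this is harmless since the entry is
    0.\<close>
  moreover have "axis (push (ang (Suc m))) 0 = axis ?i (lift m) - step (Suc (2 * m)) *\<^sub>R axis ?i ?a"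
    by (simp add: vec_eq_iff axis_def lift_def)
  ultimately show "iter (Suc (Suc (2 * m))) = iter (Suc (2 * m)) - step (Suc (2 * m)) *\<^sub>R (?v, axis ?i ?a)"
    by (simp only: iter_def scaleR_Pair diff_Pair) simp
qed

lemma iter_step: "\<exists>v \<in> clarke_subdifferential f_obj (iter k). iter (Suc k) = iter k - step k *\<^sub>R v"
proof -
  have "k = 2 * (k div 2) \<or> k = Suc (2 * (k div 2))" by presburger
  then show ?thesis using iter_even[of "k div 2"] iter_odd[of "k div 2"] by metis
qed

lemma lift_bounds: "\<bar>lift m\<bar> \<le> 3 * step (Suc (2 * m))"
  using step_pos[of "Suc (2 * m)"] a_coef_bounds[of "push (ang m)" "spiral m"]
    mult_left_mono[of "a_coef (push (ang m)) (spiral m)" 3 "step (Suc (2 * m))"]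
  by (simp add: lift_def abs_mult)

lemma norm_snd_iter: "norm (snd (iter k)) \<le> 3 * step k"
proof -
  have n: "norm (axis i c :: real^4) = \<bar>c\<bar>" for i and c :: real
    by (simp add: norm_eq_sqrt_inner inner_axis_axis)
  have "k = Suc (2 * (k div 2))" if "odd k" using that by presburger
  then show ?thesis
    using lift_bounds[of "k div 2"] step_pos[of k] by (cases "even k") (simp_all add: iter_def n)
qed

lemma snd_iter_tendsto_0: "(\<lambda>k. snd (iter k)) \<longlonglongrightarrow> 0"
proof (rule Lim_null_comparison)
  show "\<forall>\<^sub>F k in sequentially. norm (snd (iter k)) \<le> 3 * step k"
    using norm_snd_iter by (intro always_eventually allI)
  show "(\<lambda>k. 3 * step k) \<longlonglongrightarrow> 0"
    using tendsto_mult[OF tendsto_const step_tendsto_0] by fastforce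
qed

lemma f_obj_iter_tendsto_0: "(\<lambda>k. f_obj (iter k)) \<longlonglongrightarrow> 0"
proof (rule Lim_null_comparison)
  show "\<forall>\<^sub>F k in sequentially. norm (f_obj (iter k)) \<le> 12 * norm (snd (iter k))"
    using f_obj_le by (intro always_eventually allI) (metis prod.collapse real_norm_def)
  show "(\<lambda>k. 12 * norm (snd (iter k))) \<longlonglongrightarrow> 0"
    using tendsto_mult[OF tendsto_const tendsto_norm[OF snd_iter_tendsto_0]] by fastforce
qed

lemma bounded_iter: "bounded (range iter)"
  unfolding bounded_iff
proof (intro exI ballI)
  fix x assume "x \<in> range iter"
  then obtain k where k: "x = iter k" by auto
  \<comment> \<open>The final bound 7 adds 4 for the spiral and \<open>3 * step k \<le> 3\<close>
    for \<open>z\<close>.\<close>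
  have "step k \<le> 1"
    using powr_mono2'[of "- (1 / 2)" 1 "real k + K"] K by (simp add: step_def)
  moreover have "norm x \<le> norm (fst x) + norm (snd x)"
    by (metis norm_Pair_le prod.collapse)
  moreover have "norm (fst x) \<le> 4" using rad_le by (simp add: k iter_def norm_spiral)
  ultimately show "norm x \<le> 7" using norm_snd_iter[of k] by (simp add: k)
qed

section \<open>Accumulation points and nonconvergence\<close>

definition rad_lim :: real where "rad_lim = lim rad"

lemma rad_tendsto: "rad \<longlonglongrightarrow> rad_lim"
proof -
  have "convergent rad"
    using incseq_rad rad_le incseq_convergent by (metis convergentI)
  then show ?thesis by (simp add: rad_lim_def convergent_LIMSEQ_iff)
qed

lemma rad_lim_ge_1: "1 \<le> rad_lim"
  using rad_tendsto rad_ge_1 by (intro LIMSEQ_le_const) auto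

text \<open>The angle starts at 0 and is unbounded; the predecessor of the first index beyond
  \<open>T\<close> works.\<close>

lemma ex_ang_between:
  assumes "0 \<le> T"
  shows "\<exists>m. ang m \<le> T \<and> T < ang (Suc m)"
proof -
  have "\<forall>\<^sub>F m in sequentially. T < ang m"
    using filterlim_ang unfolding filterlim_at_top_dense by blast
  then obtain k where "T < ang k"
    by (auto dest: eventually_happens)
  then have T: "T < ang (LEAST m. T < ang m)" by (rule LeastI)
  have "ang 0 = 0" by (simp add: ang_def)
  with T assms have "(LEAST m. T < ang m) \<noteq> 0" by (intro notI) simp
  then obtain m where m: "(LEAST m. T < ang m) = Suc m" using not0_implies_Suc by blast
  then have "\<not> T < ang m" by (intro not_less_Least) simp
  with T m show ?thesis by (intro exI[of _ m]) simp
qed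

text \<open>In each turn, take the last index before the angle passes the target direction. The
  shortfall is at most one increment, which tends to 0, and the radius converges.\<close>

lemma spiral_accumulates: "\<exists>s. strict_mono s \<and> (\<lambda>n. spiral (s n)) \<longlonglongrightarrow> rad_lim *\<^sub>R radial \<phi>"
proof -
  \<comment> \<open>Shifting by \<open>N\<close> turns makes all targets nonnegative, also for
    negative \<open>\<phi>\<close>.\<close>
  obtain N where N: "- \<phi> / (2 * pi) \<le> real N" using real_arch_simple by blast
  define T where "T n = \<phi> + 2 * pi * real (N + n)" for n
  have T: "0 \<le> T n" for n
  proof -
    have "- \<phi> \<le> 2 * pi * real N" using N by (simp add: field_simps)
    moreover have "0 \<le> 2 * pi * real n" by simp
    ultimately show ?thesis unfolding T_def of_nat_add distrib_left by linarith
  qed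
  obtain s where s: "ang (s n) \<le> T n" "T n < ang (Suc (s n))" for n
    using ex_ang_between[OF T] by metis
  \<comment> \<open>Targets are a full turn apart, more than the bound 2 on an increment.\<close>
  have "s n < s (Suc n)" for n
  proof -
    have "ang (Suc (s n)) < T n + 2" using s(1)[of n] ang_Suc_less[of "s n"] by linarith
    also have "\<dots> \<le> T (Suc n)" using pi_gt3 by (simp add: T_def algebra_simps)
    also have "\<dots> < ang (Suc (s (Suc n)))" by (rule s(2))
    finally show ?thesis using strict_mono_ang by (simp add: strict_mono_less)
  qed
  then have sm: "strict_mono s" by (simp add: strict_mono_Suc_iff)
  have "(\<lambda>n. T n - ang (s n)) \<longlonglongrightarrow> 0"
  proof (rule tendsto_sandwich[of "\<lambda>n. 0" _ _ "\<lambda>n. arctan (slope (s n))"])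
    have "(\<lambda>m. arctan (slope m)) \<longlonglongrightarrow> arctan 0"
      by (intro tendsto_arctan slope_tendsto_0)
    then show "(\<lambda>n. arctan (slope (s n))) \<longlonglongrightarrow> 0"
      using LIMSEQ_subseq_LIMSEQ[OF _ sm] by (fastforce simp: comp_def)
    show "\<forall>\<^sub>F n in sequentially. T n - ang (s n) \<le> arctan (slope (s n))"
      using s(2) by (intro always_eventually allI) (simp add: ang_Suc less_imp_le diff_le_eq add.commute)
  qed (use s(1) in auto)
  then have "(\<lambda>n. \<phi> - (T n - ang (s n))) \<longlonglongrightarrow> \<phi> - 0"
    by (intro tendsto_intros)
  then have "(\<lambda>n. radial (\<phi> - (T n - ang (s n)))) \<longlonglongrightarrow> radial (\<phi> - 0)"
    by (rule continuous_on_tendsto_compose[OF continuous_radial]) auto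
  \<comment> \<open>The two arguments differ by \<open>N + n\<close> full turns.\<close>
  moreover have "radial (\<phi> - (T n - ang (s n))) = radial (ang (s n))" for n
    using radial_periodic[of "\<phi> - (T n - ang (s n))" "N + n"] by (simp add: T_def)
  ultimately have "(\<lambda>n. radial (ang (s n))) \<longlonglongrightarrow> radial \<phi>" by simp
  moreover have "(\<lambda>n. rad (s n)) \<longlonglongrightarrow> rad_lim"
    using LIMSEQ_subseq_LIMSEQ[OF rad_tendsto sm] by (simp add: comp_def)
  ultimately have "(\<lambda>n. spiral (s n)) \<longlonglongrightarrow> rad_lim *\<^sub>R radial \<phi>"
    unfolding spiral_def by (intro tendsto_scaleR)
  with sm show ?thesis by blast
qed

lemma accumulation_points_iter: "accumulation_points iter = {(p, 0) | p. norm p = rad_lim}"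
proof (intro set_eqI iffI)
  fix l assume "l \<in> accumulation_points iter"
  then obtain s where s: "strict_mono s" "(iter \<circ> s) \<longlonglongrightarrow> l"
    by (auto simp: accumulation_points_def)
  have "(\<lambda>n. snd (iter (s n))) \<longlonglongrightarrow> snd l"
    using tendsto_snd[OF s(2)] by (simp add: comp_def)
  moreover have "(\<lambda>n. snd (iter (s n))) \<longlonglongrightarrow> 0"
    using LIMSEQ_subseq_LIMSEQ[OF snd_iter_tendsto_0 s(1)] by (simp add: comp_def)
  ultimately have "snd l = 0" by (rule LIMSEQ_unique)
  moreover have "norm (fst l) = rad_lim"
  proof (rule LIMSEQ_unique)
    show "(\<lambda>n. norm (fst (iter (s n)))) \<longlonglongrightarrow> norm (fst l)"
      using tendsto_norm[OF tendsto_fst[OF s(2)]] by (simp add: comp_def)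
    \<comment> \<open>Halving can repeat an index, so this is a limit along a filter, not a
      subsequence.\<close>
    have "filterlim (\<lambda>n. s n div 2) sequentially sequentially"
      by (rule filterlim_compose[OF filterlim_at_top_div_const_nat filterlim_subseq[OF s(1)]]) simp
    then show "(\<lambda>n. norm (fst (iter (s n)))) \<longlonglongrightarrow> rad_lim"
      using filterlim_compose[OF rad_tendsto] by (simp add: iter_def norm_spiral)
  qed
  ultimately show "l \<in> {(p, 0) | p. norm p = rad_lim}"
    by (cases l) auto
next
  fix l :: "(real^2) \<times> (real^4)" assume "l \<in> {(p, 0) | p. norm p = rad_lim}"
  then obtain p where p: "l = (p, 0)" "norm p = rad_lim" by blast
  obtain \<phi> where "p = norm p *\<^sub>R radial \<phi>" using ex_radial by blast
  with p have l: "l = (rad_lim *\<^sub>R radial \<phi>, 0)" by simp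
  obtain s where s: "strict_mono s" "(\<lambda>n. spiral (s n)) \<longlonglongrightarrow> rad_lim *\<^sub>R radial \<phi>"
    using spiral_accumulates by blast
  \<comment> \<open>Even iterates suffice, as they are exactly \<open>(spiral m, 0)\<close>.\<close>
  have sm: "strict_mono (\<lambda>n. 2 * s n)" using s(1) by (auto simp: strict_mono_def)
  have "(\<lambda>n. (fst (iter (2 * s n)), snd (iter (2 * s n)))) \<longlonglongrightarrow> l"
    unfolding l
  proof (rule tendsto_Pair)
    show "(\<lambda>n. snd (iter (2 * s n))) \<longlonglongrightarrow> 0"
      using LIMSEQ_subseq_LIMSEQ[OF snd_iter_tendsto_0 sm] by (simp add: comp_def)
  qed (use s(2) in \<open>simp add: iter_def\<close>)
  then have "(iter \<circ> (\<lambda>n. 2 * s n)) \<longlonglongrightarrow> l" by (simp add: comp_def)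
  with sm show "l \<in> accumulation_points iter"
    unfolding accumulation_points_def by blast
qed

text \<open>A limit would be the only accumulation point, but the directions 0 and \<open>pi\<close>
  give antipodal ones, distinct because \<open>rad_lim \<ge> 1\<close>.\<close>

lemma not_convergent_iter: "\<not> convergent iter"
proof
  assume "convergent iter"
  then obtain l where l: "iter \<longlonglongrightarrow> l" by (auto simp: convergent_def)
  have "l' = l" if "l' \<in> accumulation_points iter" for l'
    using that LIMSEQ_subseq_LIMSEQ[OF l] LIMSEQ_unique unfolding accumulation_points_def by blast
  moreover have "(rad_lim *\<^sub>R radial \<phi>, 0) \<in> accumulation_points iter" for \<phi>
    using rad_lim_ge_1 by (simp add: accumulation_points_iter norm_radial)
  ultimately have "(rad_lim *\<^sub>R radial 0, 0 :: real^4) = (rad_lim *\<^sub>R radial pi, 0)" by metis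
  then have "rad_lim *\<^sub>R radial 0 $ 1 = rad_lim *\<^sub>R radial pi $ 1" by (metis fst_conv vector_scaleR_component)
  then show False using rad_lim_ge_1 by (simp add: radial_def)
qed

end

theorem theorem4p1:
  shows "locally_lipschitz f_obj \<and> semialgebraic_function f_obj \<and>
    (\<forall>K::real. K \<ge> 1 \<longrightarrow>
      (\<exists>(x :: nat \<Rightarrow> (real^2) \<times> (real^4)) (r :: real).
         bounded (range x) \<and> \<not> convergent x \<and>
         (\<forall>k. \<exists>v \<in> clarke_subdifferential f_obj (x k).
                x (Suc k) = x k - ((real k + K) powr (- (1 / 2))) *\<^sub>R v) \<and>
         r \<ge> 1 \<and>
         (\<lambda>k. f_obj (x k)) \<longlonglongrightarrow> 0 \<and>
         accumulation_points x = {(p, 0) | p. norm p = r}))"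
proof (intro conjI allI impI locally_lipschitz_f_obj semialgebraic_f_obj)
  fix K :: real assume K: "1 \<le> K"
  show "\<exists>(x :: nat \<Rightarrow> (real^2) \<times> (real^4)) (r :: real).
         bounded (range x) \<and> \<not> convergent x \<and>
         (\<forall>k. \<exists>v \<in> clarke_subdifferential f_obj (x k).
                x (Suc k) = x k - ((real k + K) powr (- (1 / 2))) *\<^sub>R v) \<and>
         r \<ge> 1 \<and>
         (\<lambda>k. f_obj (x k)) \<longlonglongrightarrow> 0 \<and>
         accumulation_points x = {(p, 0) | p. norm p = r}"
    using bounded_iter[OF K] not_convergent_iter[OF K] iter_step[OF K, unfolded step_def[OF K]]
      rad_lim_ge_1[OF K] f_obj_iter_tendsto_0[OF K] accumulation_points_iter[OF K]
    by (intro exI[of _ "iter K"] exI[of _ "rad_lim K"] conjI allI)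
qed

end
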